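(* Let $\{\mathbf{v}_i\}_{i \in I} \subseteq \mathbb{B}^k$ be a linearly attached collection. Then there exists a linearly attached collection $\{\mathbf{u}_i\}_{i \in I} \subseteq \mathbb{N}^k$ such that $\mathbf{v}_i = T(\mathbf{u}_i)$ for all $i \in I$, where $T: \mathbb{N}^k \to \mathbb{B}^k$ is the componentwise map $T(u_1,\dots,u_k) = (\varphi(u_1),\dots,\varphi(u_k))$ and $\varphi: \mathbb{N} \to \mathbb{B}$ sends $0$ to $0$ and every positive integer to $1$.
   Context: $\mathbb{N} = \{0,1,2,\dots\}$ with ordinary addition and multiplication, viewed as a semiring. $\mathbb{B} = \{0,1\}$ is the Boolean semiring with $1+1=1$ (i.e. $(\{0,1\},\max,\min)$). For a semiring $S$, $S^k$ has componentwise addition and scalar multiplication. A collection $\{\mathbf{w}_i\}_{i\in I} \subseteq S^k$ is linearly attached if there exist disjoint finite subsets $A, B \subseteq I$, not both empty, and nonzero scalars $(\lambda_a)_{a\in A}$, $(\mu_b)_{b \in B}$ in $S$ such that $\sum_{a\in A} \lambda_a \mathbf{w}_a = \sum_{b \in B} \mu_b \mathbf{w}_b$ (an empty sum being the zero vector). *)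

theory Defs
  imports "HOL-Analysis.Finite_Cartesian_Product"
begin

text \<open>The Boolean semiring, with \<open>1 + 1 = 1\<close>.  The library's two-element type in
  \<open>HOL-Library.Z2\<close> is the field with \<open>1 + 1 = 0\<close>, and \<open>bool\<close> carries no arithmetic,
  so a separate type is introduced.\<close>

datatype boolean = Zero | One

instantiation boolean :: comm_semiring_1
begin

definition zero_boolean :: boolean where "0 = Zero"

definition one_boolean :: boolean where "1 = One"

fun plus_boolean :: "boolean \<Rightarrow> boolean \<Rightarrow> boolean" where
  "Zero + Zero = Zero"
| "Zero + One = One"
| "One + Zero = One"
| "One + One = One"

fun times_boolean :: "boolean \<Rightarrow> boolean \<Rightarrow> boolean" where
  "Zero * Zero = Zero"
| "Zero * One = Zero"
| "One * Zero = Zero"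
| "One * One = One"

instance
proof
  fix a b c :: boolean
  show "a * b * c = a * (b * c)" by (cases a; cases b; cases c) simp_all
  show "a * b = b * a" by (cases a; cases b) simp_all
  show "a + b + c = a + (b + c)" by (cases a; cases b; cases c) simp_all
  show "a + b = b + a" by (cases a; cases b) simp_all
  show "(a + b) * c = a * c + b * c" by (cases a; cases b; cases c) simp_all
  show "1 * a = a" by (cases a) (simp_all add: one_boolean_def)
  show "0 + a = a" by (cases a) (simp_all add: zero_boolean_def)
  show "0 * a = 0" by (cases a) (simp_all add: zero_boolean_def)
  show "a * 0 = 0" by (cases a) (simp_all add: zero_boolean_def)
  show "(0::boolean) \<noteq> 1" by (simp add: zero_boolean_def one_boolean_def)
qed

end

text \<open>A collection \<open>{w i}\<close>, \<open>i \<in> I\<close>, is an indexed family: repeated vectors at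
  different indices count as different members, and values of \<open>w\<close> outside \<open>I\<close> are
  irrelevant.\<close>

definition linearly_attached :: "'i set \<Rightarrow> ('i \<Rightarrow> 'a::semiring_1 ^ 'k) \<Rightarrow> bool" where
  "linearly_attached I w \<longleftrightarrow>
     (\<exists>A B l m. finite A \<and> finite B \<and> A \<subseteq> I \<and> B \<subseteq> I \<and> A \<inter> B = {} \<and>
        \<not> (A = {} \<and> B = {}) \<and>
        (\<forall>a\<in>A. l a \<noteq> 0) \<and> (\<forall>b\<in>B. m b \<noteq> 0) \<and>
        (\<Sum>a\<in>A. l a *s w a) = (\<Sum>b\<in>B. m b *s w b))"

definition \<phi> :: "nat \<Rightarrow> boolean" where
  "\<phi> n = (if n = 0 then 0 else 1)"

definition T :: "nat ^ 'k \<Rightarrow> boolean ^ 'k" where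
  "T u = (\<chi> j. \<phi> (u $ j))"

end

theory Submission imports Defs begin

text \<open>Over the Boolean semiring a relation only says that the supports of the two sides have the
  same union. If coordinate \<open>j\<close> lies in the support of \<open>p\<close> members of the left side and
  \<open>q\<close> members of the right side, then \<open>p = 0\<close> iff \<open>q = 0\<close>; giving the \<open>j\<close>-entry value \<open>q\<close> on the
  left and \<open>p\<close> on the right balances both sides at \<open>p * q\<close> with all scalars equal to \<open>1\<close>.\<close>

lemma boolean_add_eq_0_iff: "x + y = 0 \<longleftrightarrow> x = 0 \<and> y = (0::boolean)"
  by (cases x; cases y) (simp_all add: zero_boolean_def)

lemma boolean_mult_eq_0_iff: "x * y = 0 \<longleftrightarrow> x = 0 \<or> y = (0::boolean)"
  by (cases x; cases y) (simp_all add: zero_boolean_def)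

lemma boolean_neq_0_iff: "x \<noteq> 0 \<longleftrightarrow> x = (1::boolean)"
  by (cases x) (simp_all add: zero_boolean_def one_boolean_def)

lemma boolean_sum_eq_0_iff:
  fixes f :: "'i \<Rightarrow> boolean"
  assumes "finite A"
  shows "sum f A = 0 \<longleftrightarrow> (\<forall>a\<in>A. f a = 0)"
  using assms by induction (simp_all add: boolean_add_eq_0_iff)

text \<open>Nothing cancels in the Boolean semiring: a sum vanishes only if all its terms do, and a
  nonzero scalar kills no entry. The scalars thus drop out, leaving a count.\<close>

lemma boolean_combination_eq_0_iff:
  fixes w :: "'i \<Rightarrow> boolean ^ 'k"
  assumes "finite A" "\<forall>a\<in>A. l a \<noteq> 0"
  shows "(\<Sum>a\<in>A. l a *s w a) $ j = 0 \<longleftrightarrow> card {a \<in> A. w a $ j \<noteq> 0} = 0"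
  using assms by (auto simp: boolean_sum_eq_0_iff boolean_mult_eq_0_iff)

theorem theorem3p15:
  fixes I :: "'i set" and v :: "'i \<Rightarrow> boolean ^ 'k"
  assumes "linearly_attached I v"
  shows "\<exists>u :: 'i \<Rightarrow> nat ^ 'k. linearly_attached I u \<and> (\<forall>i\<in>I. v i = T (u i))"
proof -
  obtain A B l m where AB: "finite A" "finite B" "A \<subseteq> I" "B \<subseteq> I" "A \<inter> B = {}"
      "\<not> (A = {} \<and> B = {})"
    and lm: "\<forall>a\<in>A. l a \<noteq> 0" "\<forall>b\<in>B. m b \<noteq> 0"
    and eq: "(\<Sum>a\<in>A. l a *s v a) = (\<Sum>b\<in>B. m b *s v b)"
    using assms unfolding linearly_attached_def by blast
  define p where "p j = card {a \<in> A. v a $ j \<noteq> 0}" for j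
  define q where "q j = card {b \<in> B. v b $ j \<noteq> 0}" for j
  \<comment> \<open>Indices outside \<open>A\<close> and \<open>B\<close> only have to keep their
    support, so 1 stands for any positive value.\<close>
  define u :: "'i \<Rightarrow> nat ^ 'k" where
    "u i = (\<chi> j. if v i $ j = 0 then 0 else if i \<in> A then q j else if i \<in> B then p j else 1)" for i
  have pq: "p j = 0 \<longleftrightarrow> q j = 0" for j
    unfolding p_def q_def boolean_combination_eq_0_iff[OF AB(1) lm(1), symmetric]
      boolean_combination_eq_0_iff[OF AB(2) lm(2), symmetric] eq ..
  have p: "p j \<noteq> 0" if "i \<in> A" "v i $ j \<noteq> 0" for i j
    using that AB(1) by (auto simp: p_def)
  have q: "q j \<noteq> 0" if "i \<in> B" "v i $ j \<noteq> 0" for i j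
    using that AB(2) by (auto simp: q_def)
  \<comment> \<open>A member of \<open>A\<close> with \<open>j\<close> in its support makes
    \<open>p j\<close> positive, hence by \<open>pq\<close> also its entry \<open>q j\<close>;
    symmetrically for \<open>B\<close>.\<close>
  have u_eq_0: "u i $ j = 0 \<longleftrightarrow> v i $ j = 0" for i j
    using pq[of j] p[of i j] q[of i j] by (auto simp: u_def)
  have "v i = T (u i)" for i
    unfolding vec_eq_iff
  proof
    show "v i $ j = T (u i) $ j" for j
      using u_eq_0[of i j] boolean_neq_0_iff[of "v i $ j"] by (cases "v i $ j = 0") (simp_all add: T_def \<phi>_def)
  qed
  moreover have "(\<Sum>a\<in>A. 1 *s u a) = (\<Sum>b\<in>B. 1 *s u b)"
  proof (intro vec_eq_iff[THEN iffD2] allI)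
    fix j
    have "(\<Sum>a\<in>A. u a $ j) = (\<Sum>a\<in>{a \<in> A. v a $ j \<noteq> 0}. q j)"
      using AB(1) by (intro sum.mono_neutral_cong_right) (auto simp: u_def)
    \<comment> \<open>\<open>u\<close> tests \<open>A\<close> first, so members of \<open>B\<close>
      receive \<open>p j\<close> because \<open>A\<close> and \<open>B\<close> are disjoint.\<close>
    moreover have "(\<Sum>b\<in>B. u b $ j) = (\<Sum>b\<in>{b \<in> B. v b $ j \<noteq> 0}. p j)"
      using AB(2,5) by (intro sum.mono_neutral_cong_right) (auto simp: u_def)
    ultimately show "(\<Sum>a\<in>A. 1 *s u a) $ j = (\<Sum>b\<in>B. 1 *s u b) $ j"
      by (simp add: p_def q_def)
  qed
  then have "linearly_attached I u"
    unfolding linearly_attached_def using AB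
    by (intro exI[of _ A] exI[of _ B] exI[of _ "\<lambda>_. 1"]) simp
  ultimately show ?thesis by blast
qed

end
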